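(* Let $q$ be an indeterminate and let $\{C_n(x|q)\}_{n\geq 1}\subset \mathbb{Q}(q)[x]$ be the sequence of polynomials defined by $C_1(x|q)=1$ and, for $n\geq 1$, $$\frac{C_{n+1}(x|q)-C_{n+1}(q^{-1}x-q^{-1}|q)}{1+(q-1)x}=C_n(qx+1|q),\qquad C_{n+1}(-\tfrac1q|q)=0.$$ Then for all $n\geq 1$, $$[n]_qC_{n+1}(x|q)=\big([2n-1]_q+xq^{2n-1}\big)C_n(x|q)+\sum_{j=0}^{n-2}[n-j-1]_q\,\widetilde C_j(q)\,C_{n-j}(x|q)\,q^{2j+1}.$$
   Context: $[m]_q=\frac{q^m-1}{q-1}=1+q+\cdots+q^{m-1}$. The polynomials $\widetilde C_j(q)$ ($j\geq 0$) are defined by $\widetilde C_0(q)=1$ and $\widetilde C_{n+1}(q)=\sum_{i=0}^{n}q^{i}\widetilde C_i(q)\widetilde C_{n-i}(q)$ for $n\geq0$; equivalently $\widetilde C_j(q)=q^{\binom j2}C_j(q^{-1})$ where $C_j(q)=\sum_{\gamma}q^{A(\gamma)}$ is the Carlitz–Riordan $q$-Catalan number, the sum running over lattice paths $\gamma$ from $(0,0)$ to $(j,j)$ with unit steps $(1,0),(0,1)$ never rising above $y=x$, and $A(\gamma)$ the area under $\gamma$ above the $x$-axis. *)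

theory Defs
  imports "HOL-Computational_Algebra.Computational_Algebra"
begin

text \<open>The field \<open>\<rat>(q)\<close> is \<^typ>\<open>rat poly fract\<close>, with \<open>qq\<close> the indeterminate \<open>q\<close>;
  polynomials in \<open>x\<close> over it form \<^typ>\<open>rat poly fract poly\<close>.\<close>

definition qq :: "rat poly fract"
  where "qq = to_fract [:0, 1:]"

definition qnat :: "'a::field \<Rightarrow> nat \<Rightarrow> 'a"
  where "qnat q m = (q ^ m - 1) / (q - 1)"

fun qCatalan :: "'a::comm_semiring_1 \<Rightarrow> nat \<Rightarrow> 'a" where
  "qCatalan q 0 = 1"
| "qCatalan q (Suc n) = (\<Sum>i\<le>n. q ^ i * qCatalan q i * qCatalan q (n - i))"

text \<open>The first equation of the recurrence is read in \<open>\<rat>(q)(x)\<close>, the fraction field of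
  \<open>\<rat>(q)[x]\<close>. The polynomials are indexed from 1, so \<open>C 0\<close> is unconstrained.\<close>

definition C_seq :: "(nat \<Rightarrow> rat poly fract poly) \<Rightarrow> bool" where
  "C_seq C \<longleftrightarrow> C 1 = 1 \<and>
     (\<forall>n\<ge>1.
        Fract (C (n + 1) - C (n + 1) \<circ>\<^sub>p [:- inverse qq, inverse qq:]) [:1, qq - 1:]
          = to_fract (C n \<circ>\<^sub>p [:1, qq:]) \<and>
        poly (C (n + 1)) (- 1 / qq) = 0)"

lemma qq_nz [simp]: "qq \<noteq> 0"
  by (simp add: qq_def)

lemma qq_power: "qq ^ m = to_fract (monom 1 m)"
proof (induction m)
  case (Suc m)
  have "monom 1 (Suc m) = [:0, 1:] * (monom 1 m :: rat poly)"
    by (simp add: monom_Suc)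
  then show ?case using Suc by (simp only: power_Suc to_fract_mult qq_def)
qed simp

lemma qq_power_neq_1: "m > 0 \<Longrightarrow> qq ^ m \<noteq> 1"
proof
  assume "m > 0" "qq ^ m = 1"
  then have "to_fract (monom 1 m :: rat poly) = to_fract 1"
    by (simp add: qq_power)
  then have "degree (monom 1 m :: rat poly) = degree (1 :: rat poly)"
    unfolding to_fract_eq_iff by simp
  with \<open>m > 0\<close> show False by (simp add: degree_monom_eq)
qed

lemma qq_neq_1 [simp]: "qq \<noteq> 1"
  using qq_power_neq_1[of 1] by simp

lemma qnat_sum: "q \<noteq> 1 \<Longrightarrow> qnat q m = (\<Sum>i<m. q ^ i)"
  by (simp add: qnat_def geometric_sum)

lemma quotient_iff:
  "Fract p [:1, qq - 1:] = to_fract r \<longleftrightarrow> p = [:1, qq - 1:] * r"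
  by (simp add: to_fract_def eq_fract mult.commute)

lemma ex_step_aux:
  "\<exists>p. p - p \<circ>\<^sub>p [:- inverse qq, inverse qq:] = [:1, qq - 1:] ^ Suc k * (h \<circ>\<^sub>p [:1, qq - 1:])"
proof (induction h arbitrary: k)
  case 0
  show ?case by (rule exI[of _ 0]) simp
next
  case (pCons a h)
  let ?S = "[:- inverse qq, inverse qq:]" and ?Y = "[:1, qq - 1:]"
  have *: "smult a (Y ^ Suc k) + Y ^ Suc (Suc k) * H = Y ^ Suc k * ([:a:] + Y * H)"
    for Y H :: "rat poly fract poly"
    by (simp add: algebra_simps)
  have **: "smult s P + p - (smult t P + p') = smult (s - t) P + (p - p')"
    for s t and P p p' :: "rat poly fract poly"
    by (simp add: smult_diff_left)
  obtain p where p: "p - p \<circ>\<^sub>p ?S = ?Y ^ Suc (Suc k) * (h \<circ>\<^sub>p ?Y)"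
    using pCons.IH by blast
  have YS: "?Y \<circ>\<^sub>p ?S = smult (inverse qq) ?Y"
    by (simp add: pcompose_pCons field_simps)
  have YkS: "(?Y ^ m) \<circ>\<^sub>p ?S = smult (inverse qq ^ m) (?Y ^ m)" for m
  proof (induction m)
    case (Suc m)
    show ?case
      by (simp only: power_Suc pcompose_mult Suc YS mult_smult_left mult_smult_right smult_smult)
        (simp add: mult.commute)
  qed (simp add: pcompose_1)
  define c where "c = a / (1 - inverse qq ^ Suc k)"
  have "inverse qq ^ Suc k \<noteq> 1"
    using qq_power_neq_1[of "Suc k"] by (metis inverse_1 inverse_inverse_eq power_inverse zero_less_Suc)
  then have c: "c - c * inverse qq ^ Suc k = a"
  proof -
    assume "inverse qq ^ Suc k \<noteq> 1"
    then have "c * (1 - inverse qq ^ Suc k) = a"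
      unfolding c_def by (simp del: power_Suc)
    then show ?thesis by (simp only: right_diff_distrib mult_1_right)
  qed
  let ?p = "smult c (?Y ^ Suc k) + p"
  have "?p - ?p \<circ>\<^sub>p ?S = smult (c - c * inverse qq ^ Suc k) (?Y ^ Suc k) + (p - p \<circ>\<^sub>p ?S)"
    unfolding pcompose_add pcompose_smult YkS smult_smult by (rule **)
  also have "\<dots> = ?Y ^ Suc k * (pCons a h \<circ>\<^sub>p ?Y)"
    unfolding c p pcompose_pCons by (rule *)
  finally show ?case by blast
qed

lemma ex_step:
  "\<exists>p. p - p \<circ>\<^sub>p [:- inverse qq, inverse qq:] = [:1, qq - 1:] * r \<and> poly p (- 1 / qq) = 0"
proof -
  let ?S = "[:- inverse qq, inverse qq:]" and ?Y = "[:1, qq - 1:]"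
  let ?Z = "[:- inverse (qq - 1), inverse (qq - 1):]"
  have "?Z \<circ>\<^sub>p ?Y = [:0, 1:]"
    by (simp add: pcompose_pCons)
  then have r: "(r \<circ>\<^sub>p ?Z) \<circ>\<^sub>p ?Y = r"
    by (metis pcompose_assoc pcompose_idR)
  obtain p where p: "p - p \<circ>\<^sub>p ?S = ?Y * r"
    using ex_step_aux[of 0 "r \<circ>\<^sub>p ?Z"] unfolding r power_Suc power_0 mult_1_right by blast
  define p' where "p' = p - [:poly p (- 1 / qq):]"
  have "p' - p' \<circ>\<^sub>p ?S = p - p \<circ>\<^sub>p ?S"
    unfolding p'_def pcompose_diff pcompose_const by simp
  then have "p' - p' \<circ>\<^sub>p ?S = ?Y * r"
    unfolding p .
  moreover have "poly p' (- 1 / qq) = 0"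
    by (simp add: p'_def)
  ultimately show ?thesis by blast
qed

lemma step_unique:
  assumes "p - p \<circ>\<^sub>p [:- inverse qq, inverse qq:] = p' - p' \<circ>\<^sub>p [:- inverse qq, inverse qq:]"
    and "poly p (- 1 / qq) = poly p' (- 1 / qq)"
  shows "p = p'"
proof -
  let ?S = "[:- inverse qq, inverse qq:]"
  define d where "d = p - p'"
  have d: "d \<circ>\<^sub>p ?S = d"
    using assms(1) unfolding d_def pcompose_diff by algebra
  have "degree d = 0"
  proof (rule ccontr)
    assume *: "degree d \<noteq> 0"
    have "lead_coeff d = lead_coeff (d \<circ>\<^sub>p ?S)"
      unfolding d ..
    also have "\<dots> = lead_coeff d * inverse qq ^ degree d"
      by (subst lead_coeff_comp) simp_all
    finally have "inverse qq ^ degree d = 1"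
      using * by auto
    then have "qq ^ degree d = 1"
      by (metis inverse_1 inverse_inverse_eq power_inverse)
    with * qq_power_neq_1 show False by blast
  qed
  then obtain c where "d = [:c:]" by (rule degree_eq_zeroE)
  moreover have "poly d (- 1 / qq) = 0"
    using assms(2) by (simp add: d_def)
  ultimately show ?thesis by (simp add: d_def)
qed

theorem ex_C_seq: "\<exists>C. C_seq C"
proof -
  define F where "F r = (SOME p. p - p \<circ>\<^sub>p [:- inverse qq, inverse qq:] =
      [:1, qq - 1:] * (r \<circ>\<^sub>p [:1, qq:]) \<and> poly p (- 1 / qq) = 0)" for r
  have F: "F r - F r \<circ>\<^sub>p [:- inverse qq, inverse qq:] = [:1, qq - 1:] * (r \<circ>\<^sub>p [:1, qq:]) \<and>
      poly (F r) (- 1 / qq) = 0" for r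
    unfolding F_def by (rule someI_ex) (rule ex_step)
  define C where "C n = (F ^^ (n - 1)) 1" for n
  have "C (n + 1) = F (C n)" if "n \<ge> 1" for n
    using that by (cases n) (simp_all add: C_def)
  then have "C_seq C"
    unfolding C_seq_def quotient_iff using F by (auto simp: C_def)
  then show ?thesis by blast
qed

theorem C_seq_unique:
  assumes "C_seq C" "C_seq C'" "n \<ge> 1"
  shows "C n = C' n"
  using \<open>n \<ge> 1\<close>
proof (induction n rule: dec_induct)
  case base
  then show ?case using assms by (simp add: C_seq_def)
next
  case (step n)
  have rec: "D (n + 1) - D (n + 1) \<circ>\<^sub>p [:- inverse qq, inverse qq:] =
               [:1, qq - 1:] * (D n \<circ>\<^sub>p [:1, qq:])"
    and val: "poly (D (n + 1)) (- 1 / qq) = 0" if "C_seq D" for D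
    using that step.hyps unfolding C_seq_def quotient_iff by blast+
  have "C (n + 1) = C' (n + 1)"
  proof (rule step_unique)
    show "C (n + 1) - C (n + 1) \<circ>\<^sub>p [:- inverse qq, inverse qq:] =
          C' (n + 1) - C' (n + 1) \<circ>\<^sub>p [:- inverse qq, inverse qq:]"
      unfolding rec[OF assms(1)] rec[OF assms(2)] step.IH ..
    show "poly (C (n + 1)) (- 1 / qq) = poly (C' (n + 1)) (- 1 / qq)"
      unfolding val[OF assms(1)] val[OF assms(2)] ..
  qed
  then show ?case by simp
qed

end

theory Submission
  imports Defs
begin

text \<open>Put \<open>y = 1 + (q - 1) x\<close> and \<open>A(u) = \<Sum>\<^sub>k q\<^sup>k\<^sup>k u\<^sup>k / ((q - 1) \<dots> (q\<^sup>k - 1))\<close>, which satisfies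
  \<open>A(u) = A(u/q) + u A(q u)\<close>. The substitutions in the recurrence act on \<open>y\<close> by \<open>y \<mapsto> y/q\<close> and
  \<open>y \<mapsto> q y\<close>, and \<open>x = -1/q\<close> is \<open>y = 1/q\<close>; hence \<open>\<Sum>\<^sub>n C\<^sub>n\<^sub>+\<^sub>1 z\<^sup>n = A(y z) / A(z/q) =: F(z)\<close>. Likewise
  the generating function of the \<open>q\<close>-Catalan numbers is \<open>c(z) = A(z) / A(z/q)\<close>. The theorem
  is the coefficient form of
  \<open>(F(q z) - F(z)) (1 - q z c(q\<^sup>2 z)) = y q z F(q\<^sup>2 z) - z F(z)\<close>,
  which follows from the functional equation of \<open>A\<close> because \<open>1 - q z c(q\<^sup>2 z) = 1 / c(q z)\<close>.\<close>

section \<open>The substitution of c z for z in formal power series\<close>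

definition fps_scale :: "'a::comm_ring_1 \<Rightarrow> 'a fps \<Rightarrow> 'a fps"
  where "fps_scale c f = Abs_fps (\<lambda>n. c ^ n * f $ n)"

lemma fps_scale_nth [simp]: "fps_scale c f $ n = c ^ n * f $ n"
  by (simp add: fps_scale_def)

lemma fps_scale_1 [simp]: "fps_scale 1 f = f"
  by (simp add: fps_eq_iff)

lemma fps_scale_one [simp]: "fps_scale c 1 = 1"
  by (simp add: fps_eq_iff)

lemma fps_scale_X [simp]: "fps_scale c fps_X = fps_const c * fps_X"
  by (simp add: fps_eq_iff fps_X_def)

lemma fps_scale_scale [simp]: "fps_scale c (fps_scale d f) = fps_scale (c * d) f"
  by (simp add: fps_eq_iff power_mult_distrib mult.assoc)

lemma fps_scale_add: "fps_scale c (f + g) = fps_scale c f + fps_scale c g"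
  by (simp add: fps_eq_iff algebra_simps)

lemma fps_scale_mult: "fps_scale c (f * g) = fps_scale c f * fps_scale c g"
proof (rule fps_ext)
  fix n
  have "c ^ n * (f $ i * g $ (n - i)) = c ^ i * f $ i * (c ^ (n - i) * g $ (n - i))"
    if "i \<in> {0..n}" for i
  proof -
    have "c ^ n = c ^ i * c ^ (n - i)"
      using that by (simp flip: power_add)
    then show ?thesis by (simp add: algebra_simps)
  qed
  then show "fps_scale c (f * g) $ n = (fps_scale c f * fps_scale c g) $ n"
    by (simp add: fps_mult_nth sum_distrib_left)
qed

section \<open>The series A and its functional equation\<close>

definition q_airy :: "'a::field \<Rightarrow> 'a fps"
  where "q_airy q = Abs_fps (\<lambda>k. q ^ k\<^sup>2 / (\<Prod>i=1..k. q ^ i - 1))"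

lemma q_airy_nth_0 [simp]: "q_airy q $ 0 = 1"
  by (simp add: q_airy_def)

lemma q_airy_nth_Suc:
  assumes "\<And>m. m > 0 \<Longrightarrow> q ^ m \<noteq> 1"
  shows "(q ^ Suc k - 1) * q_airy q $ Suc k = q ^ (2 * k + 1) * q_airy q $ k"
proof -
  have "q ^ Suc k - 1 \<noteq> 0"
    using assms[of "Suc k"] by simp
  moreover have "q ^ (Suc k)\<^sup>2 = q ^ (2 * k + 1) * q ^ k\<^sup>2"
    by (simp add: power2_eq_square mult_2 add.assoc flip: power_add)
  ultimately show ?thesis
    by (simp add: q_airy_def del: power_Suc)
qed

lemma fps_scale_q_airy_nonzero: "fps_scale c (q_airy q) \<noteq> 0"
proof
  assume "fps_scale c (q_airy q) = 0"
  then have "fps_scale c (q_airy q) $ 0 = 0" by simp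
  then show False by simp
qed

text \<open>With a_k the coefficients of A, the recurrence \<open>q_airy_nth_Suc\<close> divided by
  q^(k+1) reads a_(k+1) - a_(k+1) / q^(k+1) = q^k a_k. This is the functional equation compared at
  degree k+1; \<open>y\<close> only rescales u.\<close>

lemma q_airy_equation:
  assumes q: "q \<noteq> 0" "\<And>m. m > 0 \<Longrightarrow> q ^ m \<noteq> 1"
  shows "fps_scale y (q_airy q) =
    fps_scale (y / q) (q_airy q) + fps_const y * fps_X * fps_scale (q * y) (q_airy q)"
proof (rule fps_ext)
  fix n
  show "fps_scale y (q_airy q) $ n =
    (fps_scale (y / q) (q_airy q) + fps_const y * fps_X * fps_scale (q * y) (q_airy q)) $ n"
  proof (cases n)
    case (Suc k)
    have "q_airy q $ Suc k - q_airy q $ Suc k / q ^ Suc k =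
        ((q ^ Suc k - 1) * q_airy q $ Suc k) / q ^ Suc k"
      using q by (simp add: field_simps)
    also have "\<dots> = q ^ k * q_airy q $ k"
      by (subst q_airy_nth_Suc[OF q(2)]) (use q(1) in \<open>simp_all add: mult_2 power_add\<close>)
    finally have "q_airy q $ Suc k = q_airy q $ Suc k / q ^ Suc k + q ^ k * q_airy q $ k"
      by (simp add: algebra_simps)
    then have "y ^ Suc k * q_airy q $ Suc k =
        y ^ Suc k * (q_airy q $ Suc k / q ^ Suc k + q ^ k * q_airy q $ k)"
      by (rule arg_cong)
    then show ?thesis
      using q(1) by (simp add: Suc mult.assoc power_mult_distrib power_divide algebra_simps)
  qed (simp add: mult.assoc)
qed

section \<open>The generating function c of the q-Catalan numbers\<close>

lemma qCatalan_fps_equation: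
  "Abs_fps (qCatalan q) = 1 + fps_X * fps_scale q (Abs_fps (qCatalan q)) * Abs_fps (qCatalan q)"
proof (rule fps_ext)
  fix n
  show "Abs_fps (qCatalan q) $ n =
    (1 + fps_X * fps_scale q (Abs_fps (qCatalan q)) * Abs_fps (qCatalan q)) $ n"
  proof (cases n)
    case (Suc k)
    have "(fps_scale q (Abs_fps (qCatalan q)) * Abs_fps (qCatalan q)) $ k = qCatalan q (Suc k)"
      by (simp add: fps_mult_nth atLeast0AtMost)
    then show ?thesis
      by (simp add: Suc mult.assoc)
  qed (simp add: mult.assoc)
qed

text \<open>The factor \<open>fps_X\<close> makes each coefficient depend on earlier ones only, so
  the equation of c determines them all.\<close>

lemma qCatalan_fps_unique:
  assumes "R = 1 + fps_X * fps_scale q R * R"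
  shows "R = Abs_fps (qCatalan q)"
proof (rule fps_ext)
  fix n
  have "R $ n = qCatalan q n"
  proof (induction n rule: less_induct)
    case (less n)
    have R: "R $ n = (1 + fps_X * (fps_scale q R * R)) $ n"
      using assms by (simp add: mult.assoc)
    show ?case
    proof (cases n)
      case (Suc k)
      then have "R $ n = (fps_scale q R * R) $ k"
        using R by simp
      also have "\<dots> = (\<Sum>i\<le>k. q ^ i * R $ i * R $ (k - i))"
        by (simp add: fps_mult_nth atLeast0AtMost)
      also have "\<dots> = (\<Sum>i\<le>k. q ^ i * qCatalan q i * qCatalan q (k - i))"
        using Suc by (intro sum.cong) (simp_all add: less.IH)
      finally show ?thesis
        by (simp add: Suc)
    qed (use R in simp)
  qed
  then show "R $ n = Abs_fps (qCatalan q) $ n"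
    by simp
qed

text \<open>The quotient R(z) = A(z) / A(z/q) satisfies R(q z) R(z) = A(q z) / A(z/q). Dividing A(z)
  = A(z/q) + z A(q z) by A(z/q) therefore gives the equation that characterises c.\<close>

lemma qCatalan_fps_q_airy:
  assumes q: "q \<noteq> 0" "\<And>m. m > 0 \<Longrightarrow> q ^ m \<noteq> 1"
  shows "q_airy q = Abs_fps (qCatalan q) * fps_scale (1 / q) (q_airy q)"
proof -
  let ?A = "q_airy q" and ?A' = "fps_scale (1 / q) (q_airy q)"
  define R where "R = ?A * inverse ?A'"
  have R: "R * ?A' = ?A"
    by (simp add: R_def mult.assoc inverse_mult_eq_1)
  have qR: "fps_scale q R * ?A = fps_scale q ?A"
    using arg_cong[OF R, of "fps_scale q"] q(1) by (simp add: fps_scale_mult)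
  have "(1 + fps_X * fps_scale q R * R) * ?A' = ?A' + fps_X * (fps_scale q R * (R * ?A'))"
    by (simp add: algebra_simps)
  also have "\<dots> = ?A' + fps_X * fps_scale q ?A"
    by (simp only: R qR)
  also have "\<dots> = R * ?A'"
    using q_airy_equation[OF q, of 1] by (simp add: R)
  finally have "R = 1 + fps_X * fps_scale q R * R"
    using fps_scale_q_airy_nonzero by (metis mult_right_cancel)
  then show ?thesis
    using R qCatalan_fps_unique by metis
qed

section \<open>The identity for F and its coefficients\<close>

lemma gf_identity:
  fixes q y :: "'a::field"
  assumes q: "q \<noteq> 0" "\<And>m. m > 0 \<Longrightarrow> q ^ m \<noteq> 1"
    and F: "F * fps_scale (1 / q) (q_airy q) = fps_scale y (q_airy q)"
  shows "(fps_scale q F - F) * (1 - fps_const q * fps_X * fps_scale (q\<^sup>2) (Abs_fps (qCatalan q))) =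
    fps_const (y * q) * fps_X * fps_scale (q\<^sup>2) F - fps_X * F"
proof -
  let ?A = "q_airy q" and ?c = "Abs_fps (qCatalan q)"
  define A' A1 where "A' = fps_scale (1 / q) ?A" and "A1 = fps_scale q ?A"
  define B B1 B2 where "B = fps_scale y ?A" and "B1 = fps_scale (y * q) ?A"
    and "B2 = fps_scale (y * q\<^sup>2) ?A"
  define u where "u = 1 - fps_const q * fps_X * fps_scale (q\<^sup>2) ?c"
  define Q where "Q = fps_const (y * q) * fps_X"
  have F0: "F * A' = B"
    using F by (simp add: A'_def B_def)
  have F1: "fps_scale q F * ?A = B1"
    using arg_cong[OF F, of "fps_scale q"] q(1)
    by (simp add: fps_scale_mult B1_def mult.commute)
  have F2: "fps_scale (q\<^sup>2) F * A1 = B2"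
    using arg_cong[OF F, of "fps_scale (q\<^sup>2)"] q(1)
    by (simp add: fps_scale_mult A1_def B2_def mult.commute power2_eq_square)
  have AA: "?A = A' + fps_X * A1"
    using q_airy_equation[OF q, of 1] by (simp add: A'_def A1_def)
  have BB: "B1 = B + Q * B2"
    using q_airy_equation[OF q, of "y * q"] q(1)
    by (simp add: B_def B1_def B2_def Q_def power2_eq_square mult_ac)
  have cA: "fps_scale q ?c * ?A = A1"
    using arg_cong[OF qCatalan_fps_q_airy[OF q], of "fps_scale q"] q(1)
    by (simp add: fps_scale_mult A1_def)
  \<comment> \<open>The equation of c, taken at q z, exhibits \<open>u\<close> as the inverse of c(q
    z) = A(q z) / A(z).\<close>
  have "fps_scale q ?c = 1 + fps_const q * fps_X * fps_scale (q\<^sup>2) ?c * fps_scale q ?c"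
    using arg_cong[OF qCatalan_fps_equation[of q], of "fps_scale q"]
    by (simp add: fps_scale_mult fps_scale_add power2_eq_square)
  then have "u * fps_scale q ?c = 1"
    unfolding u_def by (simp add: algebra_simps)
  then have uA: "u * A1 = ?A"
    by (metis cA mult.assoc mult_1)
  \<comment> \<open>Multiplying by A(q z) A(z/q) clears all denominators, leaving only rescaled
    copies of A. After expanding by \<open>AA\<close> and \<open>BB\<close> the two terms
    \<open>B * A'\<close> cancel.\<close>
  have "(fps_scale q F - F) * u * (A1 * A') = (fps_scale q F * ?A) * A' - (F * A') * ?A"
    unfolding uA[symmetric] by (simp add: algebra_simps)
  also have "\<dots> = B1 * A' - B * ?A"
    unfolding F0 F1 ..
  also have "\<dots> = Q * B2 * A' - fps_X * B * A1"
    unfolding AA BB by (simp add: algebra_simps)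
  also have "\<dots> = (Q * fps_scale (q\<^sup>2) F - fps_X * F) * (A1 * A')"
    unfolding F0[symmetric] F2[symmetric] by (simp add: algebra_simps)
  finally have "(fps_scale q F - F) * u = Q * fps_scale (q\<^sup>2) F - fps_X * F"
    using fps_scale_q_airy_nonzero unfolding A'_def A1_def by (metis mult_eq_0_iff mult_right_cancel)
  then show ?thesis
    unfolding u_def Q_def .
qed

text \<open>F(q z) - F(z) has coefficients (q^k - 1) F_k; these give the left side and, convolved
  with c(q^2 z), the sum.\<close>

lemma fps_nth_recurrence:
  fixes q y :: "'a::field"
  assumes "(fps_scale q F - F) * (1 - fps_const q * fps_X * fps_scale (q\<^sup>2) c) =
    fps_const (y * q) * fps_X * fps_scale (q\<^sup>2) F - fps_X * F"
  shows "(q ^ Suc m - 1) * F $ Suc m = (y * q ^ (2 * m + 1) - 1) * F $ m +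
    (\<Sum>j<m. (q ^ (m - j) - 1) * c $ j * F $ (m - j) * q ^ (2 * j + 1))"
proof -
  let ?D = "fps_scale q F - F"
  have "?D = fps_const q * (fps_X * (fps_scale (q\<^sup>2) c * ?D)) +
      fps_const (y * q) * (fps_X * fps_scale (q\<^sup>2) F) - fps_X * F"
    using assms by (simp add: algebra_simps)
  then have "?D $ Suc m = (fps_const q * (fps_X * (fps_scale (q\<^sup>2) c * ?D)) +
      fps_const (y * q) * (fps_X * fps_scale (q\<^sup>2) F) - fps_X * F) $ Suc m"
    by (rule arg_cong)
  also have "\<dots> = q * (fps_scale (q\<^sup>2) c * ?D) $ m + y * q * (q\<^sup>2) ^ m * F $ m - F $ m"
    by simp
  also have "\<dots> = (y * q ^ (2 * m + 1) - 1) * F $ m + q * (fps_scale (q\<^sup>2) c * ?D) $ m"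
    by (simp add: algebra_simps flip: power_mult)
  also have "q * (fps_scale (q\<^sup>2) c * ?D) $ m =
      (\<Sum>j<m. (q ^ (m - j) - 1) * c $ j * F $ (m - j) * q ^ (2 * j + 1))"
  proof -
    have "q * (fps_scale (q\<^sup>2) c * ?D) $ m =
        (\<Sum>j<Suc m. (q ^ (m - j) - 1) * c $ j * F $ (m - j) * q ^ (2 * j + 1))"
      unfolding fps_mult_nth sum_distrib_left
      by (intro sum.cong) (auto simp: algebra_simps simp flip: power_mult)
    \<comment> \<open>The summand j = m vanishes, since q^0 - 1 = 0.\<close>
    then show ?thesis by simp
  qed
  finally show ?thesis
    by (simp add: left_diff_distrib)
qed

section \<open>The polynomials \<open>C n\<close> as coefficients of F\<close>

text \<open>The powers of \<open>qq\<close> make the field infinite, while a nonzero difference has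
  finitely many roots. Thus x, and with it y, may be treated as a scalar.\<close>

lemma poly_fract_eqI:
  fixes p r :: "rat poly fract poly"
  assumes "\<And>x. poly p x = poly r x"
  shows "p = r"
proof (rule ccontr)
  assume "p \<noteq> r"
  then have "finite {x. poly (p - r) x = 0}"
    by (intro poly_roots_finite) simp
  then have "finite (UNIV :: rat poly fract set)"
    using assms by simp
  moreover have "inj ((^) qq)"
  proof (rule linorder_injI)
    fix i j :: nat
    assume "i < j"
    then have "qq ^ j = qq ^ i * qq ^ (j - i)" "qq ^ (j - i) \<noteq> 1"
      by (simp_all add: qq_power_neq_1 flip: power_add)
    then show "qq ^ i \<noteq> qq ^ j" by simp
  qed
  ultimately show False
    using finite_imageD[of "(^) qq" UNIV] by (metis finite_subset infinite_UNIV_nat subset_UNIV)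
qed

definition C_fps :: "rat poly fract \<Rightarrow> rat poly fract fps"
  where "C_fps x = fps_scale (1 + (qq - 1) * x) (q_airy qq) *
    inverse (fps_scale (1 / qq) (q_airy qq))"

lemma C_fps_mult:
  "C_fps x * fps_scale (1 / qq) (q_airy qq) = fps_scale (1 + (qq - 1) * x) (q_airy qq)"
  by (simp add: C_fps_def mult.assoc inverse_mult_eq_1)

lemma C_fps_equation:
  "C_fps x = C_fps ((x - 1) / qq) + fps_const (1 + (qq - 1) * x) * fps_X * C_fps (qq * x + 1)"
proof -
  have *: "1 + (qq - 1) * ((x - 1) / qq) = (1 + (qq - 1) * x) / qq"
    "1 + (qq - 1) * (qq * x + 1) = qq * (1 + (qq - 1) * x)"
    by (simp_all add: field_simps)
  show ?thesis
    unfolding C_fps_def *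
    using arg_cong[OF q_airy_equation[of qq "1 + (qq - 1) * x"],
        of "\<lambda>f. f * inverse (fps_scale (1 / qq) (q_airy qq))"]
    by (simp add: qq_power_neq_1 algebra_simps)
qed

lemma C_fps_at_zero: "C_fps (- 1 / qq) = 1"
proof -
  have "1 + (qq - 1) * (- 1 / qq) = 1 / qq"
    by (simp add: field_simps)
  then show ?thesis
    unfolding C_fps_def by (simp add: inverse_mult_eq_1')
qed

text \<open>The coefficients of F, read as polynomials in x, satisfy the defining recurrence, so
  uniqueness identifies them with \<open>C\<close>.\<close>

lemma poly_C_seq:
  assumes "C_seq C"
  shows "poly (C (Suc n)) x = C_fps x $ n"
proof -
  \<comment> \<open>The Cauchy product for the coefficient of z^(n-1) in A(y z) / A(z/q), with y
    kept as the polynomial \<open>[:1, qq - 1:]\<close>. The shift is there because the sequence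
    starts at index 1.\<close>
  define G where "G n = (\<Sum>k\<le>n - 1. smult (q_airy qq $ k *
      inverse (fps_scale (1 / qq) (q_airy qq)) $ (n - 1 - k)) ([:1, qq - 1:] ^ k))" for n
  have G: "poly (G (Suc n)) x = C_fps x $ n" for n x
    unfolding C_fps_def fps_mult_nth by (simp add: G_def atLeast0AtMost poly_sum mult_ac)
  have "C_seq G"
    unfolding C_seq_def quotient_iff
  proof (intro conjI allI impI)
    show "G 1 = 1"
      by (simp add: G_def)
  next
    fix n :: nat
    assume "n \<ge> 1"
    then obtain m where n: "n = Suc m"
      by (cases n) auto
    show "G (n + 1) - G (n + 1) \<circ>\<^sub>p [:- inverse qq, inverse qq:] = [:1, qq - 1:] * (G n \<circ>\<^sub>p [:1, qq:])"
    proof (rule poly_fract_eqI)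
      fix x
      have *: "poly [:- inverse qq, inverse qq:] x = (x - 1) / qq"
        "poly [:1, qq:] x = qq * x + 1" "poly [:1, qq - 1:] x = 1 + (qq - 1) * x"
        by (simp_all add: field_simps)
      have "C_fps x $ Suc m = C_fps ((x - 1) / qq) $ Suc m +
          (1 + (qq - 1) * x) * C_fps (qq * x + 1) $ m"
        using arg_cong[OF C_fps_equation[of x], of "\<lambda>f. f $ Suc m"] by (simp add: mult.assoc)
      then show "poly (G (n + 1) - G (n + 1) \<circ>\<^sub>p [:- inverse qq, inverse qq:]) x =
          poly ([:1, qq - 1:] * (G n \<circ>\<^sub>p [:1, qq:])) x"
        unfolding n Suc_eq_plus1[symmetric] poly_diff poly_mult poly_pcompose G *
        by simp
    qed
    \<comment> \<open>There F = 1, and the coefficient in question has positive degree n.\<close>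
    show "poly (G (n + 1)) (- 1 / qq) = 0"
      unfolding n Suc_eq_plus1[symmetric] G C_fps_at_zero by simp
  qed
  then show ?thesis
    using C_seq_unique[OF assms] G by simp
qed

theorem theorem2:
  fixes C :: "nat \<Rightarrow> rat poly fract poly" and n :: nat
  assumes "C_seq C" and "n \<ge> 1"
  shows "smult (qnat qq n) (C (n + 1)) =
           [:qnat qq (2 * n - 1), qq ^ (2 * n - 1):] * C n +
           (\<Sum>j<n - 1. smult (qnat qq (n - j - 1) * qCatalan qq j) (C (n - j)) *
                        [:qq ^ (2 * j + 1):])"
proof (rule poly_fract_eqI)
  fix x
  obtain m where n: "n = Suc m"
    using assms(2) by (cases n) auto
  have qnat: "qnat qq k = (qq ^ k - 1) / (qq - 1)" for k
    by (simp add: qnat_def)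
  have "(qq ^ Suc m - 1) * C_fps x $ Suc m =
      ((1 + (qq - 1) * x) * qq ^ (2 * m + 1) - 1) * C_fps x $ m +
      (\<Sum>j<m. (qq ^ (m - j) - 1) * qCatalan qq j * C_fps x $ (m - j) * qq ^ (2 * j + 1))"
    using fps_nth_recurrence[OF gf_identity[OF _ _ C_fps_mult]] by (simp add: qq_power_neq_1)
  \<comment> \<open>Division by q - 1 turns each q^k - 1 into a q-number. In the leading factor, y t
    - 1 = (t - 1) + (q - 1) x t splits off the term x t, where t = q^(2m+1).\<close>
  then have "(qq ^ Suc m - 1) * C_fps x $ Suc m / (qq - 1) =
      (((1 + (qq - 1) * x) * qq ^ (2 * m + 1) - 1) * C_fps x $ m +
      (\<Sum>j<m. (qq ^ (m - j) - 1) * qCatalan qq j * C_fps x $ (m - j) * qq ^ (2 * j + 1))) / (qq - 1)"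
    by (rule arg_cong)
  also have "\<dots> = (qnat qq (2 * m + 1) + x * qq ^ (2 * m + 1)) * C_fps x $ m +
      (\<Sum>j<m. qnat qq (m - j) * qCatalan qq j * C_fps x $ (m - j) * qq ^ (2 * j + 1))"
  proof -
    have "((1 + (qq - 1) * x) * t - 1) / (qq - 1) = (t - 1) / (qq - 1) + x * t" for t
      by (simp add: field_simps)
    then show ?thesis
      unfolding add_divide_distrib sum_divide_distrib qnat times_divide_eq_left[symmetric]
      by simp
  qed
  finally have *: "qnat qq (Suc m) * C_fps x $ Suc m =
      (qnat qq (2 * m + 1) + x * qq ^ (2 * m + 1)) * C_fps x $ m +
      (\<Sum>j<m. qnat qq (m - j) * qCatalan qq j * C_fps x $ (m - j) * qq ^ (2 * j + 1))"
    by (simp add: qnat)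
  \<comment> \<open>For j < m, \<open>Suc m - j\<close> equals \<open>Suc (m - j)\<close>, so
    \<open>C (n - j)\<close> corresponds to the coefficient of index m - j.\<close>
  have "poly (\<Sum>j<m. smult (qnat qq (m - j) * qCatalan qq j) (C (Suc m - j)) * [:qq ^ (2 * j + 1):]) x =
      (\<Sum>j<m. qnat qq (m - j) * qCatalan qq j * C_fps x $ (m - j) * qq ^ (2 * j + 1))"
    unfolding poly_sum
    by (intro sum.cong) (simp_all add: Suc_diff_le poly_C_seq[OF assms(1)])
  then show "poly (smult (qnat qq n) (C (n + 1))) x =
      poly ([:qnat qq (2 * n - 1), qq ^ (2 * n - 1):] * C n +
        (\<Sum>j<n - 1. smult (qnat qq (n - j - 1) * qCatalan qq j) (C (n - j)) *
                     [:qq ^ (2 * j + 1):])) x"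
    using * by (simp add: n poly_C_seq[OF assms(1)] algebra_simps del: power_Suc)
qed

end
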